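(* Let $E:\mathbb{R}^n\to\mathbb{R}^n$ and $\Psi:\mathbb{R}^n\times\mathbb{R}^n\to\mathbb{R}^n$ be maps. If the functions $h:\mathbb{R}^n\to\mathbb{R}$ and $h_j:\mathbb{R}^n\to\mathbb{R}$, $1\le j\le k$, are SQSEP w.r.t. $\Psi$ on $\mathbb{R}^n$, then the set of optimal solutions of the problem (P): minimize $h(s)$ subject to $h_j(s)\le 0$, $1\le j\le k$, $s\in\mathbb{R}^n$, is an SEI set w.r.t. $\Psi$.
   Context: Write $Es$ for $E(s)$. A set $S\subseteq\mathbb{R}^n$ is strongly $E$-invex (SEI) w.r.t. $\Psi$ if $\alpha t+Et+\lambda\Psi(\alpha s+Es,\alpha t+Et)\in S$ for all $s,t\in S$, $\alpha\in[0,1]$, $\lambda\in[0,1]$. A function $h:\mathbb{R}^n\to\mathbb{R}$ is semi quasi strongly $E$-preinvex (SQSEP) w.r.t. $\Psi$ on an SEI set $S$ if $h(\alpha t+Et+\lambda\Psi(\alpha s+Es,\alpha t+Et))\le\max\{h(s),h(t)\}$ for all $s,t\in S$, $\alpha,\lambda\in[0,1]$ ($\mathbb{R}^n$ itself is an SEI set). With $X=\{s\in\mathbb{R}^n:h_j(s)\le0,\ 1\le j\le k\}$ the feasible set, the set of optimal solutions of (P) is $X_{opt}=\{s\in X:h(s)=\beta\}$ where $\beta=\min_{s\in X}h(s)$, i.e. the set of minimizers of $h$ over $X$. *)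

theory Defs
  imports "HOL-Analysis.Analysis"
begin

definition strongly_E_invex ::
  "('a::real_vector \<Rightarrow> 'a) \<Rightarrow> ('a \<Rightarrow> 'a \<Rightarrow> 'a) \<Rightarrow> 'a set \<Rightarrow> bool" where
  "strongly_E_invex E \<Psi> S \<longleftrightarrow>
     (\<forall>s\<in>S. \<forall>t\<in>S. \<forall>\<alpha>\<in>{0..1::real}. \<forall>l\<in>{0..1::real}.
        \<alpha> *\<^sub>R t + E t + l *\<^sub>R \<Psi> (\<alpha> *\<^sub>R s + E s) (\<alpha> *\<^sub>R t + E t) \<in> S)"

text \<open>The notion only makes sense on a strongly E-invex set, so this is part of the definition.\<close>

definition semi_quasi_strongly_E_preinvex_on ::
  "('a::real_vector \<Rightarrow> 'a) \<Rightarrow> ('a \<Rightarrow> 'a \<Rightarrow> 'a) \<Rightarrow> 'a set \<Rightarrow> ('a \<Rightarrow> real) \<Rightarrow> bool" where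
  "semi_quasi_strongly_E_preinvex_on E \<Psi> S h \<longleftrightarrow>
     strongly_E_invex E \<Psi> S \<and>
     (\<forall>s\<in>S. \<forall>t\<in>S. \<forall>\<alpha>\<in>{0..1::real}. \<forall>l\<in>{0..1::real}.
        h (\<alpha> *\<^sub>R t + E t + l *\<^sub>R \<Psi> (\<alpha> *\<^sub>R s + E s) (\<alpha> *\<^sub>R t + E t)) \<le> max (h s) (h t))"

definition feasible_set :: "(nat \<Rightarrow> 'a \<Rightarrow> real) \<Rightarrow> nat \<Rightarrow> 'a set" where
  "feasible_set hc k = {s. \<forall>j\<in>{1..k}. hc j s \<le> 0}"

text \<open>All minimizers of the objective over the feasible set; this is empty if the minimum
  is not attained.\<close>

definition optimal_solutions :: "('a \<Rightarrow> real) \<Rightarrow> (nat \<Rightarrow> 'a \<Rightarrow> real) \<Rightarrow> nat \<Rightarrow> 'a set" where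
  "optimal_solutions h hc k = {s. is_arg_min h (\<lambda>x. x \<in> feasible_set hc k) s}"

end

theory Submission
  imports Defs
begin

text \<open>A quasi-convexity argument: every sublevel set \<open>{s. f s \<le> c}\<close> of an
  SQSEP function \<open>f\<close> is SEI, because the value at the new point is at most
  \<open>max (f s) (f t)\<close>. The optimal set is an intersection of such sets, namely those of
  the \<open>hc j\<close> at level 0 and those of \<open>h\<close> at the levels \<open>h x\<close>
  for feasible \<open>x\<close>; SEI survives intersection.\<close>

theorem theorem25:
  fixes E :: "real ^ 'n \<Rightarrow> real ^ 'n"
    and \<Psi> :: "real ^ 'n \<Rightarrow> real ^ 'n \<Rightarrow> real ^ 'n"
    and h :: "real ^ 'n \<Rightarrow> real"
    and hc :: "nat \<Rightarrow> real ^ 'n \<Rightarrow> real"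
    and k :: nat
  assumes "semi_quasi_strongly_E_preinvex_on E \<Psi> UNIV h"
    and "\<And>j. j \<in> {1..k} \<Longrightarrow> semi_quasi_strongly_E_preinvex_on E \<Psi> UNIV (hc j)"
  shows "strongly_E_invex E \<Psi> (optimal_solutions h hc k)"
proof -
  \<comment> \<open>The level \<open>c\<close> is kept free so that the same fact serves the
    constraints and the objective.\<close>
  have conv: "f (\<alpha> *\<^sub>R t + E t + l *\<^sub>R \<Psi> (\<alpha> *\<^sub>R s + E s) (\<alpha> *\<^sub>R t + E t)) \<le> c"
    if "semi_quasi_strongly_E_preinvex_on E \<Psi> UNIV f" "f s \<le> c" "f t \<le> c"
      "\<alpha> \<in> {0..1}" "l \<in> {0..1}" for f s t \<alpha> l c
    using that unfolding semi_quasi_strongly_E_preinvex_on_def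
    by (meson UNIV_I max.boundedI order_trans)
  \<comment> \<open>Since the reals are linearly ordered, having no strictly better feasible point
    means \<open>h s \<le> h x\<close> for all feasible \<open>x\<close>. No minimum value is named,
    so an unattained minimum needs no separate case.\<close>
  have opt_iff: "s \<in> optimal_solutions h hc k \<longleftrightarrow>
      s \<in> feasible_set hc k \<and> (\<forall>x\<in>feasible_set hc k. h s \<le> h x)" for s
    by (auto simp: optimal_solutions_def is_arg_min_linorder)
  show ?thesis
    unfolding strongly_E_invex_def
  proof (intro ballI)
    fix s t and \<alpha> l :: real
    assume s: "s \<in> optimal_solutions h hc k" and t: "t \<in> optimal_solutions h hc k"
      and \<alpha>: "\<alpha> \<in> {0..1}" and l: "l \<in> {0..1}"
    let ?z = "\<alpha> *\<^sub>R t + E t + l *\<^sub>R \<Psi> (\<alpha> *\<^sub>R s + E s) (\<alpha> *\<^sub>R t + E t)"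
    have "hc j ?z \<le> 0" if "j \<in> {1..k}" for j
      using s t that by (intro conv[OF assms(2)] \<alpha> l) (auto simp: opt_iff feasible_set_def)
    then have "?z \<in> feasible_set hc k"
      by (simp add: feasible_set_def)
    \<comment> \<open>Here the level is \<open>h x\<close>, which bounds \<open>h s\<close> and
      \<open>h t\<close> by optimality of \<open>s\<close> and \<open>t\<close>.\<close>
    moreover have "h ?z \<le> h x" if "x \<in> feasible_set hc k" for x
      using s t that by (intro conv[OF assms(1)] \<alpha> l) (auto simp: opt_iff)
    ultimately show "?z \<in> optimal_solutions h hc k"
      by (simp add: opt_iff)
  qed
qed

end
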